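(* Let $h_{k,n}$ be the number of column-convex polyominoes having $k$ columns and area $n$. Then: 1. $h_{k,k}=1$ for $k\geq 1$. 2. $h_{k,k+1}=4k-4$ for $k\geq 2$. 3. $h_{k,k+2}=8k^2-19k+16$ for $k\geq 3$.
   Context: A cell is a unit square of the lattice $\mathbb{Z}^2$. A polyomino is a finite (nonempty) union of cells, connected through their edges, without a cut point, and considered up to translation. Its area is the number of its cells. A polyomino is column-convex if its intersection with any vertical line is connected; its number of columns is the number of vertical unit-width strips it occupies. *)

theory Defs
  imports "HOL-Analysis.Analysis"
begin

type_synonym cell = "int \<times> int"

(* A cell is named by the lower left corner of its unit square. *)
definition unit_square :: "cell \<Rightarrow> (real \<times> real) set" where
  "unit_square c =
     {of_int (fst c) .. of_int (fst c) + 1} \<times> {of_int (snd c) .. of_int (snd c) + 1}"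

(* The finite union of cells is represented by the set C of its cells, which it determines;
   region C is the union itself, as a closed subset of the plane. *)
definition region :: "cell set \<Rightarrow> (real \<times> real) set" where
  "region C = (\<Union>c\<in>C. unit_square c)"

definition share_edge :: "cell \<Rightarrow> cell \<Rightarrow> bool" where
  "share_edge c d \<longleftrightarrow> \<bar>fst c - fst d\<bar> + \<bar>snd c - snd d\<bar> = 1"

definition edge_connected :: "cell set \<Rightarrow> bool" where
  "edge_connected C \<longleftrightarrow>
     (\<forall>c\<in>C. \<forall>d\<in>C. (c, d) \<in> {(a, b). a \<in> C \<and> b \<in> C \<and> share_edge a b}\<^sup>*)"

definition cut_point :: "(real \<times> real) set \<Rightarrow> real \<times> real \<Rightarrow> bool" where
  "cut_point R p \<longleftrightarrow> p \<in> R \<and> \<not> connected (R - {p})"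

(* Before identification up to translation. *)
definition polyomino :: "cell set \<Rightarrow> bool" where
  "polyomino C \<longleftrightarrow>
     finite C \<and> C \<noteq> {} \<and> edge_connected C \<and> (\<nexists>p. cut_point (region C) p)"

definition column_convex :: "cell set \<Rightarrow> bool" where
  "column_convex C \<longleftrightarrow> (\<forall>x. connected (region C \<inter> {p. fst p = x}))"

definition area :: "cell set \<Rightarrow> nat" where
  "area C = card C"

definition num_columns :: "cell set \<Rightarrow> nat" where
  "num_columns C = card (fst ` C)"

definition translation_rel :: "(cell set \<times> cell set) set" where
  "translation_rel = {(C, D). \<exists>v. D = (\<lambda>c. c + v) ` C}"

definition h :: "nat \<Rightarrow> nat \<Rightarrow> nat" where
  "h k n =
     card ({C. polyomino C \<and> column_convex C \<and> num_columns C = k \<and> area C = n}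
           // translation_rel)"

end

theory Submission
  imports Defs
begin

text \<open>
  Every column of a column-convex polyomino is a vertical bar, given by its bottom and its height.
  In a region connected through edges, two neighbouring columns must share an edge, that is, the
  two bars must meet in at least one row (lemma \<open>column_convex_polyomino_is_chain\<close>).  Conversely
  any nonempty sequence of bars in which neighbours meet is a column-convex polyomino.  Its region
  has no cut point because a rectangle stays connected when one point is removed, and
  neighbouring rectangles have a whole unit edge in common, which one point cannot destroy
  (lemma \<open>no_cut_point_cells_of\<close>).  A translation class contains exactly one such sequence
  in which the first bar stands in column \<open>0\<close> with its bottom at \<open>0\<close>
  (lemma \<open>h_eq_card_chains\<close>).

  Next to a bar of height \<open>m\<close>, a bar of height \<open>m'\<close> can be placed in \<open>m + m' - 1\<close> ways.  Hence a
  polyomino is counted by a choice of heights, weighted by the product of these numbers over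
  neighbouring columns.  With \<open>k\<close> columns and area \<open>k + e\<close> the heights exceed \<open>1\<close> by a total of only
  \<open>e\<close>, so it is convenient to record the excess \<open>r\<close> of a column over height \<open>1\<close>; the weight of
  neighbouring excesses \<open>r\<close> and \<open>s\<close> is then \<open>r + s + 1\<close>.  Splitting off the first column gives a
  recursion in the number of columns (\<open>num_chains\<close>), which for total excess \<open>0\<close>, \<open>1\<close> and \<open>2\<close> has
  solutions that agree, once \<open>k > e\<close>, with polynomials in \<open>k\<close> of degree \<open>0\<close>, \<open>1\<close> and \<open>2\<close>.
\<close>

section \<open>Chains of overlapping columns\<close>

text \<open>
  A pair \<open>(a, r)\<close> describes a column of \<open>r + 1\<close> cells with lowest cell at height \<open>a\<close>.  Recording the
  excess \<open>r\<close> instead of the height rules out empty columns and makes the total of the second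
  components exactly the area minus the number of columns.
\<close>
definition overlap :: "int \<times> nat \<Rightarrow> int \<times> nat \<Rightarrow> bool" where
  "overlap c d \<longleftrightarrow> fst c \<le> fst d + int (snd d) \<and> fst d \<le> fst c + int (snd c)"

definition column_ys :: "int \<times> nat \<Rightarrow> int set" where
  "column_ys c = {fst c .. fst c + int (snd c)}"

definition cells_of :: "int \<Rightarrow> (int \<times> nat) list \<Rightarrow> cell set" where
  "cells_of x xs = (\<Union>i<length xs. {x + int i} \<times> column_ys (xs ! i))"

lemma mem_cells_of:
  "(u, y) \<in> cells_of x xs \<longleftrightarrow> (\<exists>i<length xs. u = x + int i \<and> y \<in> column_ys (xs ! i))"
  by (auto simp: cells_of_def)

lemma column_ys_nonempty: "column_ys c \<noteq> {}"
  by (simp add: column_ys_def)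

lemma column_ys_eq_iff: "column_ys c = column_ys d \<longleftrightarrow> c = d"
  by (auto simp: column_ys_def Icc_eq_Icc prod_eq_iff)

lemma card_column_ys: "card (column_ys c) = Suc (snd c)"
  by (simp add: column_ys_def)

lemma overlap_iff_meet: "overlap c d \<longleftrightarrow> column_ys c \<inter> column_ys d \<noteq> {}"
proof
  assume "overlap c d"
  then have "max (fst c) (fst d) \<in> column_ys c \<inter> column_ys d"
    by (auto simp: overlap_def column_ys_def)
  then show "column_ys c \<inter> column_ys d \<noteq> {}" by blast
qed (auto simp: overlap_def column_ys_def)

lemma column_at:
  "{y. (x + int i, y) \<in> cells_of x xs} = (if i < length xs then column_ys (xs ! i) else {})"
  by (auto simp: mem_cells_of)

lemma fst_cells_of: "fst ` cells_of x xs = (\<lambda>i. x + int i) ` {..<length xs}"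
  by (simp add: cells_of_def image_UN column_ys_nonempty UNION_singleton_eq_range)

lemma finite_cells_of: "finite (cells_of x xs)"
  by (auto simp: cells_of_def column_ys_def)

lemma num_columns_cells_of: "num_columns (cells_of x xs) = length xs"
  by (simp add: num_columns_def fst_cells_of card_image inj_on_def)

lemma area_cells_of: "area (cells_of x xs) = length xs + sum_list (map snd xs)"
proof -
  have "area (cells_of x xs) = (\<Sum>i<length xs. card ({x + int i} \<times> column_ys (xs ! i)))"
    unfolding area_def cells_of_def
    by (rule card_UN_disjoint) (auto simp: column_ys_def)
  also have "\<dots> = (\<Sum>i<length xs. Suc (snd (xs ! i)))"
    by (simp add: card_cartesian_product card_column_ys)
  also have "\<dots> = length xs + sum_list (map snd xs)"
    by (simp add: sum_Suc sum_list_sum_nth atLeast0LessThan)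
  finally show ?thesis .
qed

text \<open>
  The occupied columns form an interval, which determines \<open>x\<close>; the rows occupied in each of them
  form a nonempty interval, which determines the corresponding pair.
\<close>
lemma cells_of_inject:
  assumes "cells_of x xs = cells_of x' xs'" "xs \<noteq> []"
  shows "x = x' \<and> xs = xs'"
proof -
  have len: "length xs = length xs'"
    using assms(1) num_columns_cells_of by metis
  have fsts: "fst ` cells_of z zs = {z ..< z + int (length zs)}" for z zs
  proof -
    have "u \<in> (\<lambda>i. z + int i) ` {..<length zs}" if "z \<le> u" "u < z + int (length zs)" for u
      by (rule image_eqI[where x = "nat (u - z)"]) (use that in auto)
    then show ?thesis unfolding fst_cells_of by auto
  qed
  have "{x ..< x + int (length xs)} = {x' ..< x' + int (length xs)}"
    using fsts[of x xs] fsts[of x' xs'] assms(1) len by simp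
  then have x: "x = x'"
    using assms(2) by (metis add.commute atLeastLessThan_inj(1) length_greater_0_conv less_add_same_cancel2 of_nat_0_less_iff)
  have "xs ! i = xs' ! i" if "i < length xs" for i
    using column_at[of x i xs] column_at[of x i xs'] assms(1) that len x column_ys_eq_iff by simp
  with len x show ?thesis by (simp add: nth_equalityI)
qed

lemma translate_cells_of:
  "(\<lambda>c. c + v) ` cells_of x xs = cells_of (x + fst v) (map (\<lambda>c. (fst c + snd v, snd c)) xs)"
proof (intro set_eqI)
  fix p :: cell
  obtain u y v1 v2 where [simp]: "p = (u, y)" "v = (v1, v2)" by (cases p, cases v)
  have "p \<in> (\<lambda>c. c + v) ` S \<longleftrightarrow> p - v \<in> S" for S
    by (metis (no_types, lifting) add_diff_cancel diff_add_cancel image_iff)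
  then have "p \<in> (\<lambda>c. c + v) ` cells_of x xs \<longleftrightarrow> (u - v1, y - v2) \<in> cells_of x xs"
    by simp
  also have "\<dots> \<longleftrightarrow> p \<in> cells_of (x + fst v) (map (\<lambda>c. (fst c + snd v, snd c)) xs)"
    unfolding \<open>p = (u, y)\<close> mem_cells_of
    by (intro ex_cong1) (auto simp: column_ys_def)
  finally show "p \<in> (\<lambda>c. c + v) ` cells_of x xs \<longleftrightarrow>
    p \<in> cells_of (x + fst v) (map (\<lambda>c. (fst c + snd v, snd c)) xs)" .
qed

section \<open>Chains of columns are column-convex polyominoes\<close>

definition column_rectangle :: "int \<Rightarrow> int \<times> nat \<Rightarrow> (real \<times> real) set" where
  "column_rectangle x c =
     {of_int x .. of_int x + 1} \<times> {of_int (fst c) .. of_int (fst c) + real (snd c) + 1}"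

lemma region_column: "region ({x} \<times> column_ys c) = column_rectangle x c"
proof (intro set_eqI iffI)
  fix p assume "p \<in> region ({x} \<times> column_ys c)"
  then show "p \<in> column_rectangle x c"
    by (force simp: region_def unit_square_def column_ys_def column_rectangle_def)
next
  fix p assume p: "p \<in> column_rectangle x c"
  \<comment> \<open>The top edge belongs to the top cell, although its floor lies one above that cell.\<close>
  define y where "y = min \<lfloor>snd p\<rfloor> (fst c + int (snd c))"
  have "y \<in> column_ys c"
    using p by (auto simp: y_def column_ys_def column_rectangle_def mem_Times_iff le_floor_iff)
  moreover have "p \<in> unit_square (x, y)"
    using p unfolding y_def column_rectangle_def unit_square_def mem_Times_iff by (auto simp: min_def) linarith+
  ultimately show "p \<in> region ({x} \<times> column_ys c)"
    by (auto simp: region_def)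
qed

lemma region_cells_of:
  "region (cells_of x xs) = (\<Union>i<length xs. column_rectangle (x + int i) (xs ! i))"
proof -
  have "region (cells_of x xs) = (\<Union>i<length xs. region ({x + int i} \<times> column_ys (xs ! i)))"
    by (auto simp: region_def cells_of_def)
  then show ?thesis by (simp add: region_column)
qed

text \<open>
  A vertical line meets the rectangle of one column in a segment.  When it runs along the boundary
  of two neighbouring columns it meets both, and there the two segments have a point in common
  because the columns overlap.
\<close>
lemma column_convex_cells_of:
  assumes "successively overlap xs"
  shows "column_convex (cells_of x xs)"
  unfolding column_convex_def
proof
  fix X :: real
  define S where "S = region (cells_of x xs) \<inter> {p. fst p = X}"
  define B where "B i = {X} \<times> {real_of_int (fst (xs ! i)) .. of_int (fst (xs ! i)) + real (snd (xs ! i)) + 1}" for i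
  \<comment> \<open>\<open>I\<close> collects the columns whose closed strip contains the line: at most two, and consecutive.\<close>
  define I where "I = {i. i < length xs \<and> of_int x + real i \<le> X \<and> X \<le> of_int x + real i + 1}"
  have S: "S = (\<Union>i\<in>I. B i)"
    by (auto simp: S_def B_def I_def region_cells_of column_rectangle_def)
  have conn: "connected (B i)" for i
    by (simp add: B_def connected_Times)
  have pair: "connected (B i \<union> B j)" if "i \<in> I" "j \<in> I" "i \<le> j" for i j
  proof (cases "i = j")
    case True
    then show ?thesis by (simp add: conn)
  next
    case False
    have "j \<le> Suc i" using that by (auto simp: I_def)
    with False that have j: "j = Suc i" by simp
    then have "overlap (xs ! i) (xs ! j)"
      using assms that(2) by (auto simp: successively_conv_nth I_def)
    then have "(X, max (of_int (fst (xs ! i))) (of_int (fst (xs ! j)))) \<in> B i \<inter> B j"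
      unfolding overlap_def B_def by auto
    then have "B i \<inter> B j \<noteq> {}" by blast
    with conn show ?thesis by (simp add: connected_Un)
  qed
  have "connected_component S p q" if pq: "p \<in> S" "q \<in> S" for p q
  proof -
    obtain i j where ij: "i \<in> I" "p \<in> B i" "j \<in> I" "q \<in> B j" using pq S by auto
    have "connected (B i \<union> B j)"
      using pair[of i j] pair[of j i] ij by (metis Un_commute linorder_linear)
    moreover have "B i \<union> B j \<subseteq> S" using S ij by auto
    ultimately show ?thesis using ij unfolding connected_component_def by blast
  qed
  then show "connected (region (cells_of x xs) \<inter> {p. fst p = X})"
    unfolding S_def[symmetric] connected_iff_connected_component by blast
qed

lemma connected_chain_UN:
  fixes A :: "nat \<Rightarrow> 'a::topological_space set"
  assumes "\<And>i. i < n \<Longrightarrow> connected (A i)"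
    and "\<And>i. Suc i < n \<Longrightarrow> A i \<inter> A (Suc i) \<noteq> {}"
  shows "connected (\<Union>i<n. A i)"
  using assms
proof (induction n)
  case (Suc n)
  show ?case
  proof (cases n)
    case 0
    then show ?thesis using Suc.prems(1)[of 0] by (simp add: lessThan_Suc)
  next
    case (Suc m)
    have "connected (\<Union>i<n. A i)" using Suc.IH Suc.prems by simp
    moreover have "(\<Union>i<n. A i) \<inter> A n \<noteq> {}"
      using Suc.prems(2)[of m] \<open>n = Suc m\<close> by auto
    ultimately have "connected ((\<Union>i<n. A i) \<union> A n)"
      using Suc.prems(1)[of n] by (intro connected_Un) auto
    then show ?thesis by (simp add: lessThan_Suc Un_commute)
  qed
qed simp

text \<open>A convex set of dimension two stays connected when countably many points are removed.\<close>
lemma connected_punctured_column: "connected (column_rectangle x c - {p})"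
proof -
  let ?a = "(of_int x, of_int (fst c)) :: real \<times> real"
  let ?b = "(of_int x + 1, of_int (fst c) + real (snd c) + 1) :: real \<times> real"
  have eq: "column_rectangle x c = cbox ?a ?b"
    by (simp add: column_rectangle_def cbox_Pair_eq)
  have "interior (cbox ?a ?b) \<noteq> {}"
    by (simp add: interior_cbox box_ne_empty Basis_prod_def inner_Pair)
  then have "aff_dim (cbox ?a ?b) = 2"
    by (simp add: aff_dim_nonempty_interior)
  then have "\<not> collinear (cbox ?a ?b)"
    by (simp add: collinear_aff_dim)
  then show ?thesis
    unfolding eq by (intro connected_convex_diff_countable) auto
qed

lemma no_cut_point_cells_of:
  assumes "successively overlap xs"
  shows "\<not> cut_point (region (cells_of x xs)) p"
proof -
  have meet: "(column_rectangle (x + int i) (xs ! i) - {p})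
      \<inter> (column_rectangle (x + int (Suc i)) (xs ! Suc i) - {p}) \<noteq> {}" if "Suc i < length xs" for i
  proof -
    define t where "t = max (fst (xs ! i)) (fst (xs ! Suc i))"
    have ov: "overlap (xs ! i) (xs ! Suc i)"
      using assms that by (simp add: successively_conv_nth)
    \<comment> \<open>The common boundary contains a whole unit edge, hence a point other than \<open>p\<close>.\<close>
    have "(of_int (x + int (Suc i)), of_int t + s) \<in> column_rectangle (x + int i) (xs ! i)
        \<inter> column_rectangle (x + int (Suc i)) (xs ! Suc i)" if "s \<in> {0, 1}" for s
      using ov that unfolding overlap_def t_def column_rectangle_def by (auto simp: max_def)
    from this[of 0] this[of 1] show ?thesis
      by (cases "p = (of_int (x + int (Suc i)), of_int t + 0)") auto
  qed
  have "connected (\<Union>i<length xs. column_rectangle (x + int i) (xs ! i) - {p})"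
    by (rule connected_chain_UN) (simp add: connected_punctured_column, erule meet)
  also have "(\<Union>i<length xs. column_rectangle (x + int i) (xs ! i) - {p}) = region (cells_of x xs) - {p}"
    unfolding region_cells_of by blast
  finally show ?thesis
    by (simp add: cut_point_def)
qed

text \<open>
  Every cell is joined to the lowest cell of the first column: descend to the lowest cell of its
  column, cross to the previous column in a common row, and repeat.
\<close>
lemma edge_connected_cells_of:
  assumes "successively overlap xs"
  shows "edge_connected (cells_of x xs)"
proof -
  let ?C = "cells_of x xs"
  define R where "R = {(a, b). a \<in> ?C \<and> b \<in> ?C \<and> share_edge a b}"
  have sym: "(d, c) \<in> R\<^sup>*" if "(c, d) \<in> R\<^sup>*" for c d
  proof -
    have "R\<inverse> = R" by (auto simp: R_def share_edge_def abs_minus_commute)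
    with that show ?thesis by (metis rtrancl_converseI)
  qed
  let ?b = "\<lambda>i. (x + int i, fst (xs ! i))"
  have down: "((x + int i, y), ?b i) \<in> R\<^sup>*" if "i < length xs" "y \<in> column_ys (xs ! i)" for i y
  proof -
    have "((x + int i, fst (xs ! i) + int n), ?b i) \<in> R\<^sup>*" if "n \<le> snd (xs ! i)" for n
      using that
    proof (induction n)
      case (Suc n)
      have "((x + int i, fst (xs ! i) + int (Suc n)), (x + int i, fst (xs ! i) + int n)) \<in> R"
        using Suc.prems \<open>i < length xs\<close> by (auto simp: R_def mem_cells_of column_ys_def share_edge_def)
      with Suc show ?case by (meson Suc_leD converse_rtrancl_into_rtrancl)
    qed simp
    from this[of "nat (y - fst (xs ! i))"] that(2) show ?thesis
      by (auto simp: column_ys_def)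
  qed
  have step: "(?b (Suc i), ?b i) \<in> R\<^sup>*" if i: "Suc i < length xs" for i
  proof -
    obtain y where y: "y \<in> column_ys (xs ! i)" "y \<in> column_ys (xs ! Suc i)"
      using assms i by (auto simp: successively_conv_nth overlap_iff_meet)
    have "((x + int (Suc i), y), (x + int i, y)) \<in> R"
      using y i Suc_lessD[OF i] by (auto simp: R_def mem_cells_of share_edge_def)
    then show ?thesis
      using down[OF Suc_lessD[OF i] y(1)] sym[OF down[OF i y(2)]]
      by (meson converse_rtrancl_into_rtrancl rtrancl_trans)
  qed
  have base: "(?b i, ?b 0) \<in> R\<^sup>*" if "i < length xs" for i
    using that
  proof (induction i)
    case (Suc i)
    then show ?case using step[of i] by (meson Suc_lessD rtrancl_trans)
  qed simp
  have "(c, ?b 0) \<in> R\<^sup>*" if "c \<in> ?C" for c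
    using that down base by (cases c) (auto simp: mem_cells_of intro: rtrancl_trans)
  then have "(c, d) \<in> R\<^sup>*" if "c \<in> ?C" "d \<in> ?C" for c d
    using that sym by (meson rtrancl_trans)
  then show ?thesis by (auto simp: edge_connected_def R_def)
qed

lemma polyomino_cells_of:
  assumes "successively overlap xs" "xs \<noteq> []"
  shows "polyomino (cells_of x xs)"
proof -
  have "cells_of x xs \<noteq> {}"
    using assms(2) fst_cells_of[of x xs] by auto
  with assms show ?thesis
    by (simp add: polyomino_def finite_cells_of edge_connected_cells_of no_cut_point_cells_of)
qed

section \<open>Column-convex polyominoes are chains of columns\<close>

text \<open>A path from a cell with \<open>P\<close> to a cell without \<open>P\<close> loses the property at one of its edges.\<close>
lemma edge_connected_crossing:
  assumes "edge_connected C" "c \<in> C" "P c" "d \<in> C" "\<not> P d"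
  shows "\<exists>a\<in>C. \<exists>b\<in>C. share_edge a b \<and> P a \<and> \<not> P b"
proof (rule ccontr)
  assume no: "\<not> ?thesis"
  have "(c, d) \<in> {(a, b). a \<in> C \<and> b \<in> C \<and> share_edge a b}\<^sup>*"
    using assms by (simp add: edge_connected_def)
  then have "P d"
    by (induction rule: rtrancl_induct) (use \<open>P c\<close> no in auto)
  with assms show False by simp
qed

text \<open>
  An edge that crosses from the cells with abscissa at most \<open>u\<close> to the others is horizontal.  This
  gives at once that no column between two occupied ones is empty and that neighbouring columns
  share a row.
\<close>
lemma adjacent_columns_meet:
  assumes "edge_connected C" "(i, y) \<in> C" "(j, z) \<in> C" "i \<le> u" "u < j"
  shows "\<exists>t. (u, t) \<in> C \<and> (u + 1, t) \<in> C"
proof -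
  obtain a b where "a \<in> C" "b \<in> C" "share_edge a b" "fst a \<le> u" "\<not> fst b \<le> u"
    using edge_connected_crossing[OF assms(1,2) _ assms(3), of "\<lambda>c. fst c \<le> u"] assms by auto
  moreover from this have "fst a = u" "fst b = u + 1" "snd a = snd b"
    by (auto simp: share_edge_def)
  ultimately show ?thesis by (metis prod.collapse)
qed

text \<open>
  The line through the midpoints of the cells of column \<open>i\<close> meets no other column, and a midpoint
  belongs to no cell but its own.  So if both outer cells are present, connectedness of the
  intersection forces the midpoint of the cell in between into the region, and with it the cell.
\<close>
lemma column_convex_between:
  assumes "column_convex C" "(i, y) \<in> C" "(i, z) \<in> C" "y \<le> t" "t \<le> z"
  shows "(i, t) \<in> C"
proof -
  define S where "S = region C \<inter> {p. fst p = real_of_int i + 1/2}"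
  have mem: "of_int v + 1/2 \<in> snd ` S \<longleftrightarrow> (i, v) \<in> C" for v
  proof
    assume "(i, v) \<in> C"
    then have "(of_int i + 1/2, of_int v + 1/2) \<in> S"
      by (force simp: S_def region_def unit_square_def)
    then show "of_int v + 1/2 \<in> snd ` S" by force
  next
    assume "of_int v + 1/2 \<in> snd ` S"
    then obtain c where c: "c \<in> C" "(of_int i + 1/2, of_int v + 1/2) \<in> unit_square c"
      by (force simp: S_def region_def)
    then have "fst c = i" "snd c = v" by (auto simp: unit_square_def)
    with c show "(i, v) \<in> C" by (metis prod.collapse)
  qed
  have "connected (snd ` S)"
    using assms(1) by (intro connected_continuous_image)
      (auto simp: S_def column_convex_def intro!: continuous_intros)
  moreover have "of_int y + 1/2 \<in> snd ` S" "of_int z + 1/2 \<in> snd ` S"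
    using assms(2,3) by (simp_all only: mem)
  moreover have "real_of_int y + 1/2 \<le> of_int t + 1/2" "real_of_int t + 1/2 \<le> of_int z + 1/2"
    using assms(4,5) by simp_all
  ultimately have "of_int t + 1/2 \<in> snd ` S"
    by (rule connectedD_interval)
  then show ?thesis by (simp add: mem)
qed

lemma column_convex_polyomino_is_chain:
  assumes "polyomino C" "column_convex C"
  shows "\<exists>x xs. xs \<noteq> [] \<and> successively overlap xs \<and> C = cells_of x xs"
proof -
  have fin: "finite C" and ne: "C \<noteq> {}" and ec: "edge_connected C"
    using assms by (auto simp: polyomino_def)
  define x where "x = Min (fst ` C)"
  define w where "w = Max (fst ` C)"
  have xC: "x \<in> fst ` C" and wC: "w \<in> fst ` C"
    using fin ne by (auto simp: x_def w_def)
  have bounds: "x \<le> fst c" "fst c \<le> w" if "c \<in> C" for c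
    using fin that by (auto simp: x_def w_def)
  have meet: "\<exists>t. (u, t) \<in> C \<and> (u + 1, t) \<in> C" if "x \<le> u" "u < w" for u
    using adjacent_columns_meet[OF ec _ _ that] xC wC by fastforce
  define k where "k = nat (w - x + 1)"
  define Y where "Y u = {y. (u, y) \<in> C}" for u
  have xw: "x \<le> w" using bounds ne by fastforce
  have Y: "\<exists>c. Y u = column_ys c" if "x \<le> u" "u \<le> w" for u
  proof -
    have "Y u \<noteq> {}"
      using meet[of u] wC that by (cases "u = w") (auto simp: Y_def)
    moreover have "finite (Y u)"
      using finite_vimageI[OF fin, of "Pair u"] by (simp add: Y_def vimage_def inj_on_def)
    ultimately have m: "Min (Y u) \<in> Y u" "Max (Y u) \<in> Y u" "\<And>y. y \<in> Y u \<Longrightarrow> Min (Y u) \<le> y \<and> y \<le> Max (Y u)"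
      by auto
    have "Y u = {Min (Y u) .. Max (Y u)}"
    proof (intro set_eqI iffI)
      fix t assume "t \<in> {Min (Y u) .. Max (Y u)}"
      then show "t \<in> Y u"
        using column_convex_between[OF assms(2), of u "Min (Y u)" "Max (Y u)" t] m(1,2)
        by (simp add: Y_def)
    qed (use m(3) in simp)
    moreover have "Min (Y u) \<le> Max (Y u)" using m by blast
    ultimately have "Y u = column_ys (Min (Y u), nat (Max (Y u) - Min (Y u)))"
      by (simp add: column_ys_def)
    then show ?thesis by blast
  qed
  then obtain col where col: "\<And>u. x \<le> u \<Longrightarrow> u \<le> w \<Longrightarrow> Y u = column_ys (col u)"
    by metis
  define xs where "xs = map (\<lambda>i. col (x + int i)) [0..<k]"
  have len: "length xs = k" and nth: "\<And>i. i < k \<Longrightarrow> column_ys (xs ! i) = Y (x + int i)"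
    using col by (auto simp: xs_def k_def)
  have "successively overlap xs"
    unfolding successively_conv_nth
  proof (intro allI impI)
    fix i assume i: "Suc i < length xs"
    then have "\<exists>t. (x + int i, t) \<in> C \<and> (x + int i + 1, t) \<in> C"
      using len by (intro meet) (auto simp: k_def)
    then have "column_ys (xs ! i) \<inter> column_ys (xs ! Suc i) \<noteq> {}"
      using i len nth[of i] nth[of "Suc i"] by (auto simp: Y_def algebra_simps)
    then show "overlap (xs ! i) (xs ! Suc i)" by (simp add: overlap_iff_meet)
  qed
  moreover have "xs \<noteq> []" using len xw by (auto simp: k_def)
  moreover have "C = cells_of x xs"
  proof (intro set_eqI iffI)
    fix c assume c: "c \<in> C"
    with bounds[OF c] have "nat (fst c - x) < k" "fst c = x + int (nat (fst c - x))"
      by (auto simp: k_def)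
    moreover have "snd c \<in> Y (fst c)" using c by (simp add: Y_def)
    ultimately have "(fst c, snd c) \<in> cells_of x xs"
      unfolding mem_cells_of using nth len by metis
    then show "c \<in> cells_of x xs" by simp
  next
    fix c assume "c \<in> cells_of x xs"
    then have "(fst c, snd c) \<in> cells_of x xs" by simp
    then have "snd c \<in> Y (fst c)" unfolding mem_cells_of using nth len by metis
    then show "c \<in> C" by (simp add: Y_def)
  qed
  ultimately show ?thesis by blast
qed

section \<open>Translation classes\<close>

text \<open>
  Chains of \<open>k + 1\<close> columns with first column \<open>(a, r)\<close> and total excess \<open>e\<close>.  Translation classes
  need only \<open>a = 0\<close>, but the recursion for their number removes the first column and then meets
  chains with another bottom.
\<close>
definition chains :: "nat \<Rightarrow> int \<Rightarrow> nat \<Rightarrow> nat \<Rightarrow> (int \<times> nat) list set" where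
  "chains k a r e = {xs. length xs = Suc k \<and> hd xs = (a, r) \<and> successively overlap xs
     \<and> sum_list (map snd xs) = e}"

lemma chains_subset_total: "xs \<in> chains k a r e \<Longrightarrow> r \<le> e"
  by (cases xs) (auto simp: chains_def)

lemma translation_relI: "D = (\<lambda>c. c + v) ` C \<Longrightarrow> (C, D) \<in> translation_rel"
  unfolding translation_rel_def by blast

lemma translation_relE:
  assumes "(C, D) \<in> translation_rel"
  obtains v where "D = (\<lambda>c. c + v) ` C"
  using assms unfolding translation_rel_def by blast

lemma equiv_translation: "equiv UNIV translation_rel"
proof (rule equivI)
  show "refl translation_rel"
  proof (rule reflI)
    fix C :: "cell set"
    have "C = (\<lambda>c. c + 0) ` C" by simp
    then show "(C, C) \<in> translation_rel" by (rule translation_relI)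
  qed
  show "sym translation_rel"
  proof (rule symI)
    fix C D assume "(C, D) \<in> translation_rel"
    then obtain v where "D = (\<lambda>c. c + v) ` C" by (rule translation_relE)
    then have "C = (\<lambda>c. c + (- v)) ` D" by (auto simp: image_image)
    then show "(D, C) \<in> translation_rel" by (rule translation_relI)
  qed
  show "trans translation_rel"
  proof (rule transI)
    fix C D E assume "(C, D) \<in> translation_rel" "(D, E) \<in> translation_rel"
    then obtain v w where "D = (\<lambda>c. c + v) ` C" "E = (\<lambda>c. c + w) ` D"
      by (elim translation_relE)
    then have "E = (\<lambda>c. c + (v + w)) ` C" by (simp add: image_image add.assoc)
    then show "(C, E) \<in> translation_rel" by (rule translation_relI)
  qed
qed auto

text \<open>
  Chains with bottom \<open>0\<close>, placed so as to start in column \<open>0\<close>, are representatives of the translation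
  classes: any chain can be moved there, and a vector that moves one representative to another
  vanishes because it preserves the first column and its bottom.
\<close>
lemma h_eq_card_chains: "h (Suc k) (Suc k + e) = card (\<Union>r\<le>e. chains k 0 r e)"
proof -
  define S where "S = {C. polyomino C \<and> column_convex C \<and> num_columns C = Suc k \<and> area C = Suc k + e}"
  define L where "L = (\<Union>r\<le>e. chains k 0 r e)"
  define f where "f xs = translation_rel `` {cells_of 0 xs}" for xs
  have L: "xs \<in> L \<longleftrightarrow> length xs = Suc k \<and> fst (hd xs) = 0 \<and> successively overlap xs
      \<and> sum_list (map snd xs) = e" for xs
  proof -
    have "snd (hd xs) \<le> e" if "length xs = Suc k" "sum_list (map snd xs) = e"
      using that by (cases xs) auto
    then show ?thesis by (auto simp: L_def chains_def prod_eq_iff)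
  qed
  have LS: "cells_of 0 xs \<in> S" if "xs \<in> L" for xs
  proof -
    from that have "xs \<noteq> []" by (auto simp: L)
    with that show ?thesis
      by (simp add: S_def L polyomino_cells_of column_convex_cells_of num_columns_cells_of area_cells_of)
  qed
  have SL: "\<exists>xs\<in>L. (cells_of 0 xs, C) \<in> translation_rel" if "C \<in> S" for C
  proof -
    have "polyomino C" "column_convex C" using that by (auto simp: S_def)
    then obtain x xs where xs: "xs \<noteq> []" "successively overlap xs" and C: "C = cells_of x xs"
      using column_convex_polyomino_is_chain by blast
    define b where "b = fst (hd xs)"
    define ys where "ys = map (\<lambda>c. (fst c - b, snd c)) xs"
    have "length ys = Suc k" "sum_list (map snd ys) = e"
      using that by (simp_all add: S_def C num_columns_cells_of area_cells_of ys_def comp_def)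
    moreover have "fst (hd ys) = 0" using xs by (simp add: ys_def b_def hd_map)
    moreover have "successively overlap ys"
    proof -
      have "overlap (fst c - b, snd c) (fst d - b, snd d) \<longleftrightarrow> overlap c d" for c d
        by (auto simp: overlap_def)
      with xs(2) show ?thesis by (simp add: ys_def successively_map)
    qed
    ultimately have "ys \<in> L" by (simp add: L)
    moreover have "C = (\<lambda>c. c + (x, b)) ` cells_of 0 ys"
      by (simp add: translate_cells_of C ys_def comp_def)
    ultimately show ?thesis using translation_relI by blast
  qed
  have "S // translation_rel = f ` L"
  proof (intro equalityI subsetI)
    fix K assume "K \<in> S // translation_rel"
    then obtain C where C: "C \<in> S" "K = translation_rel `` {C}" by (rule quotientE)
    then obtain xs where "xs \<in> L" "(cells_of 0 xs, C) \<in> translation_rel" using SL by blast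
    with C show "K \<in> f ` L"
      using equiv_class_eq[OF equiv_translation] by (auto simp: f_def)
  next
    fix K assume "K \<in> f ` L"
    then show "K \<in> S // translation_rel" using LS by (auto simp: f_def intro: quotientI)
  qed
  moreover have "inj_on f L"
  proof (rule inj_onI)
    fix xs ys assume xy: "xs \<in> L" "ys \<in> L" "f xs = f ys"
    then have ne: "ys \<noteq> []" "xs \<noteq> []" by (auto simp: L)
    have "(cells_of 0 xs, cells_of 0 ys) \<in> translation_rel"
      using xy(3) eq_equiv_class[OF _ equiv_translation] by (auto simp: f_def)
    then obtain v where "cells_of 0 ys = (\<lambda>c. c + v) ` cells_of 0 xs"
      by (rule translation_relE)
    then have "cells_of 0 ys = cells_of (fst v) (map (\<lambda>c. (fst c + snd v, snd c)) xs)"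
      by (simp add: translate_cells_of)
    then have ys: "ys = map (\<lambda>c. (fst c + snd v, snd c)) xs"
      using cells_of_inject ne by blast
    then have "snd v = 0" using xy ne by (simp add: L hd_map)
    with ys show "xs = ys" by simp
  qed
  ultimately show ?thesis
    by (simp add: h_def S_def L_def card_image)
qed

section \<open>Counting chains\<close>

text \<open>
  The number of chains of \<open>k + 1\<close> columns whose first column has excess \<open>r\<close> and lowest cell at a
  prescribed height, when the total excess is \<open>e\<close>.  The factor \<open>r + s + 1\<close> counts the positions of a
  second column of excess \<open>s\<close>.
\<close>
fun num_chains :: "nat \<Rightarrow> nat \<Rightarrow> nat \<Rightarrow> nat" where
  "num_chains 0 r e = (if r = e then 1 else 0)"
| "num_chains (Suc k) r e =
     (if r \<le> e then \<Sum>s\<le>e - r. (r + s + 1) * num_chains k s (e - r) else 0)"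

lemma chains_0: "chains 0 a r e = (if r = e then {[(a, r)]} else {})"
  by (auto simp: chains_def length_Suc_conv)

lemma chains_Suc:
  assumes "r \<le> e"
  shows "chains (Suc k) a r e =
    Cons (a, r) ` (\<Union>s\<le>e - r. \<Union>b\<in>{a - int s .. a + int r}. chains k b s (e - r))"
    (is "?L = Cons _ ` ?R")
proof (intro set_eqI iffI)
  fix xs assume xs: "xs \<in> ?L"
  then obtain b s ys where eq: "xs = (a, r) # (b, s) # ys"
    by (auto simp: chains_def length_Suc_conv)
  with xs have "(b, s) # ys \<in> chains k b s (e - r)" and "overlap (a, r) (b, s)"
    by (auto simp: chains_def)
  moreover from this have "s \<le> e - r" by (simp add: chains_subset_total)
  ultimately have "(b, s) # ys \<in> ?R"
    by (intro UN_I[of s] UN_I[of b]) (auto simp: overlap_def)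
  with eq show "xs \<in> Cons (a, r) ` ?R" by blast
next
  fix xs assume "xs \<in> Cons (a, r) ` ?R"
  then obtain s b ys where "xs = (a, r) # ys" "b \<in> {a - int s .. a + int r}" "ys \<in> chains k b s (e - r)"
    by auto
  with assms show "xs \<in> ?L"
    by (cases ys) (auto simp: chains_def overlap_def)
qed

text \<open>
  The second column \<open>(b, s)\<close> overlaps \<open>(a, r)\<close> exactly when \<open>a - s \<le> b \<le> a + r\<close>, which leaves
  \<open>r + s + 1\<close> values of \<open>b\<close>, each with the same number of continuations.
\<close>
lemma card_chains: "finite (chains k a r e) \<and> card (chains k a r e) = num_chains k r e"
proof (induction k arbitrary: a r e)
  case 0
  then show ?case by (simp add: chains_0)
next
  case (Suc k)
  show ?case
  proof (cases "r \<le> e")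
    case False
    then have "chains (Suc k) a r e = {}" using chains_subset_total by blast
    with False show ?thesis by simp
  next
    case True
    define U where "U s = (\<Union>b\<in>{a - int s .. a + int r}. chains k b s (e - r))" for s
    have hd_disj: "chains k b s m \<inter> chains k b' s' m = {}" if "(b, s) \<noteq> (b', s')" for b s b' s' m
      using that by (auto simp: chains_def)
    have fin: "finite (U s)" for s using Suc by (auto simp: U_def)
    have "card (U s) = (\<Sum>b\<in>{a - int s .. a + int r}. card (chains k b s (e - r)))" for s
      unfolding U_def by (rule card_UN_disjoint) (use Suc hd_disj in auto)
    then have U: "card (U s) = (r + s + 1) * num_chains k s (e - r)" for s
      using Suc by (simp add: nat_add_distrib)
    have "card (\<Union>s\<le>e - r. U s) = (\<Sum>s\<le>e - r. card (U s))"
      by (rule card_UN_disjoint) (use fin in \<open>auto simp: U_def chains_def\<close>)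
    moreover have "chains (Suc k) a r e = Cons (a, r) ` (\<Union>s\<le>e - r. U s)"
      using chains_Suc[OF True] by (simp add: U_def)
    ultimately show ?thesis
      using True fin U by (simp add: card_image)
  qed
qed

lemma h_eq_sum_num_chains: "h (Suc k) (Suc k + e) = (\<Sum>r\<le>e. num_chains k r e)"
proof -
  have "card (\<Union>r\<le>e. chains k 0 r e) = (\<Sum>r\<le>e. card (chains k 0 r e))"
    by (rule card_UN_disjoint) (use card_chains in \<open>auto simp: chains_def\<close>)
  then show ?thesis by (simp only: h_eq_card_chains card_chains)
qed

lemma num_chains_excess_0: "num_chains k 0 0 = 1"
  by (induction k) auto

text \<open>
  A lone column has no neighbour that could be shifted along it, so for positive total excess
  \<open>num_chains 0\<close> does not fit the polynomial pattern and the formulas start at \<open>Suc k\<close>.  For total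
  excess \<open>2\<close> the recursion carries this irregularity one step further.
\<close>
lemma num_chains_excess_1:
  "num_chains (Suc k) 1 1 = 2" "num_chains (Suc k) 0 1 = 4 * k + 2"
proof -
  show *: "num_chains (Suc k) 1 1 = 2" for k by (simp add: num_chains_excess_0)
  have rec: "num_chains (Suc k) 0 1 = num_chains k 0 1 + 2 * num_chains k 1 1" for k
    by simp
  show "num_chains (Suc k) 0 1 = 4 * k + 2"
  proof (induction k)
    case (Suc k)
    show ?case unfolding rec[of "Suc k"] Suc * by simp
  qed simp
qed

lemma atMost_2: "{..2} = {0, 1, 2::nat}"
  by auto

lemma num_chains_excess_2:
  "num_chains (Suc k) 2 2 = 3"
  "num_chains (Suc (Suc k)) 1 2 = 8 * k + 10"
  "int (num_chains (Suc (Suc k)) 0 2) = 8 * (int k)\<^sup>2 + 21 * int k + 18"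
proof -
  show A: "num_chains (Suc k) 2 2 = 3" for k by (simp add: num_chains_excess_0)
  have rec1: "num_chains (Suc k) 1 2 = 2 * num_chains k 0 1 + 3 * num_chains k 1 1" for k
    by simp
  from this[of "Suc _"] show B: "num_chains (Suc (Suc k)) 1 2 = 8 * k + 10" for k
    unfolding num_chains_excess_1 by simp
  have rec0: "num_chains (Suc k) 0 2 = num_chains k 0 2 + 2 * num_chains k 1 2 + 3 * num_chains k 2 2" for k
    by (simp add: atMost_2)
  show "int (num_chains (Suc (Suc k)) 0 2) = 8 * (int k)\<^sup>2 + 21 * int k + 18"
  proof (induction k)
    case 0
    show ?case unfolding rec0[of "Suc 0"] rec0[of 0] rec1[of 0] A by simp
  next
    case (Suc k)
    have "int (num_chains (Suc (Suc (Suc k))) 0 2)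
        = int (num_chains (Suc (Suc k)) 0 2) + 2 * int (8 * k + 10) + 3 * 3"
      unfolding rec0[of "Suc (Suc k)"] A B by simp
    then show ?case unfolding Suc by (simp add: power2_eq_square algebra_simps)
  qed
qed

theorem theorem5p1:
  shows "(\<forall>k::nat. k \<ge> 1 \<longrightarrow> h k k = 1) \<and>
    (\<forall>k::nat. k \<ge> 2 \<longrightarrow> int (h k (k + 1)) = 4 * int k - 4) \<and>
    (\<forall>k::nat. k \<ge> 3 \<longrightarrow> int (h k (k + 2)) = 8 * (int k)\<^sup>2 - 19 * int k + 16)"
proof (intro conjI allI impI)
  fix k :: nat
  assume "k \<ge> 1"
  then obtain j where "k = Suc j" by (cases k) auto
  then show "h k k = 1"
    using h_eq_sum_num_chains[of j 0] by (simp add: num_chains_excess_0)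
next
  fix k :: nat
  assume "k \<ge> 2"
  then obtain j where k: "k = Suc (Suc j)" by (metis Suc_le_D numeral_2_eq_2 Suc_le_mono)
  have "h k (k + 1) = num_chains (Suc j) 0 1 + num_chains (Suc j) 1 1"
    unfolding k h_eq_sum_num_chains by (simp only: One_nat_def sum.atMost_Suc atMost_0 sum.insert) simp
  then show "int (h k (k + 1)) = 4 * int k - 4"
    unfolding num_chains_excess_1 by (simp add: k)
next
  fix k :: nat
  assume "k \<ge> 3"
  then obtain j where k: "k = Suc (Suc (Suc j))" by (metis Suc_le_D numeral_3_eq_3 Suc_le_mono)
  have "h k (k + 2) = num_chains (Suc (Suc j)) 0 2 + num_chains (Suc (Suc j)) 1 2
      + num_chains (Suc (Suc j)) 2 2"
    unfolding k h_eq_sum_num_chains by (simp add: atMost_2 del: num_chains.simps)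
  then have "int (h k (k + 2)) = 8 * (int j)\<^sup>2 + 29 * int j + 31"
    by (simp add: num_chains_excess_2 del: num_chains.simps One_nat_def)
  then show "int (h k (k + 2)) = 8 * (int k)\<^sup>2 - 19 * int k + 16"
    by (simp add: k power2_eq_square algebra_simps)
qed

end
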